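(* Let $p$ be a prime and let $M$ be a (nondegenerate) finite quadratic module whose order is a power of $p$. Suppose $\dim_{\mathbb{F}_p} (M\otimes \mathbb{F}_p)\le 2$. Then $\mathrm{Inv}(M)\neq 0$ if and only if $|M|$ is a perfect square and $\sigma(M)=1$.
   Context: A finite quadratic module is a finite abelian group $M$ with a map $Q_M:M\to\mathbb{Q}/\mathbb{Z}$ such that $Q_M(ax)=a^2Q_M(x)$ for all $x\in M$, $a\in\mathbb{Z}$, and such that $B_M(x,y):=Q_M(x+y)-Q_M(x)-Q_M(y)$ is $\mathbb{Z}$-bilinear; it is nondegenerate if $B_M(x,y)=0$ for all $y$ implies $x=0$. Write $e(t)=\exp(2\pi i t)$. The metaplectic group $\mathrm{Mp}=\mathrm{Mp}_2(\mathbb{Z})$ is the group of pairs $(A,w)$ with $A=[a,b;c,d]\in \mathrm{SL}_2(\mathbb{Z})$ and $w$ a holomorphic function on the upper half plane $\mathbb{H}$ with $w(\tau)^2=c\tau+d$, with product $(A,w)(B,v)=(AB,w(B\tau)v(\tau))$. Let $T=[1,1;0,1]$, $S=[0,-1;1,0]$, and $w_S(\tau)=\sqrt{\tau}$ (branch with positive real part). Put $\sigma(M)=|M|^{-1/2}\sum_{x\in M}e(-Q_M(x))$. The Weil representation $W(M)$ is the complex vector space with basis $\{\mathfrak{e}_x: x\in M\}$ equipped with the unique left action of $\mathrm{Mp}$ such that $(T,1)\mathfrak{e}_x=e(Q_M(x))\mathfrak{e}_x$ and $(S,w_S)\mathfrak{e}_x=\sigma(M)|M|^{-1/2}\sum_{y\in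 M}e(-B_M(y,x))\mathfrak{e}_y$. $\mathrm{Inv}(M)$ denotes the subspace of $\mathrm{Mp}$-invariant vectors in $W(M)$. *)

theory Defs
  imports "HOL-Complex_Analysis.Complex_Analysis"
begin

text \<open>A finite quadratic module is modelled by a finite abelian group (type class
  finite + ab_group_add) together with a map Q into rationals, read modulo the integers
  (i.e. a lift of Q_M : M -> Q/Z).\<close>

definition zmult :: "int \<Rightarrow> 'a::ab_group_add \<Rightarrow> 'a" where
  "zmult a x = (if 0 \<le> a then (\<Sum>i<nat a. x) else - (\<Sum>i<nat (- a). x))"

definition Bf :: "('a::ab_group_add \<Rightarrow> rat) \<Rightarrow> 'a \<Rightarrow> 'a \<Rightarrow> rat" where
  "Bf Q x y = Q (x + y) - Q x - Q y"

definition is_fqm :: "('a::{finite,ab_group_add} \<Rightarrow> rat) \<Rightarrow> bool" where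
  "is_fqm Q \<longleftrightarrow>
     (\<forall>x a. Q (zmult a x) - of_int (a^2) * Q x \<in> \<int>) \<and>
     (\<forall>x y z. Bf Q (x + y) z - Bf Q x z - Bf Q y z \<in> \<int>) \<and>
     (\<forall>x y z. Bf Q x (y + z) - Bf Q x y - Bf Q x z \<in> \<int>)"

definition nondegenerate :: "('a::{finite,ab_group_add} \<Rightarrow> rat) \<Rightarrow> bool" where
  "nondegenerate Q \<longleftrightarrow> (\<forall>x. (\<forall>y. Bf Q x y \<in> \<int>) \<longrightarrow> x = 0)"

text \<open>dim over F_p of M tensor F_p = M/pM.\<close>
definition pM_quotient :: "nat \<Rightarrow> 'a::{finite,ab_group_add} set set" where
  "pM_quotient p = (UNIV :: 'a set) // {(x, y). x - y \<in> range (zmult (int p))}"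

definition fp_dim :: "nat \<Rightarrow> 'a::{finite,ab_group_add} itself \<Rightarrow> nat" where
  "fp_dim p (_ :: 'a itself) = (THE d. p ^ d = card (pM_quotient p :: 'a set set))"

definition ee :: "rat \<Rightarrow> complex" where
  "ee t = exp (2 * of_real pi * \<i> * of_rat t)"

definition sigma :: "('a::{finite,ab_group_add} \<Rightarrow> rat) \<Rightarrow> complex" where
  "sigma Q = (\<Sum>x\<in>UNIV. ee (- Q x)) / of_real (sqrt (real CARD('a)))"

text \<open>Vectors of W(M) are coefficient functions v, v = sum_x v(x) e_x.\<close>
definition T_op :: "('a::{finite,ab_group_add} \<Rightarrow> rat) \<Rightarrow> ('a \<Rightarrow> complex) \<Rightarrow> ('a \<Rightarrow> complex)" where
  "T_op Q v = (\<lambda>x. ee (Q x) * v x)"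

definition S_op :: "('a::{finite,ab_group_add} \<Rightarrow> rat) \<Rightarrow> ('a \<Rightarrow> complex) \<Rightarrow> ('a \<Rightarrow> complex)" where
  "S_op Q v = (\<lambda>y. sigma Q / of_real (sqrt (real CARD('a))) *
                    (\<Sum>x\<in>UNIV. ee (- Bf Q y x) * v x))"

type_synonym mat2 = "int \<times> int \<times> int \<times> int"
type_synonym mp_elt = "mat2 \<times> (complex \<Rightarrow> complex)"

definition uhp :: "complex set" where "uhp = {\<tau>. Im \<tau> > 0}"

fun moeb :: "mat2 \<Rightarrow> complex \<Rightarrow> complex" where
  "moeb (a, b, c, d) \<tau> = (of_int a * \<tau> + of_int b) / (of_int c * \<tau> + of_int d)"

fun mat_mult :: "mat2 \<Rightarrow> mat2 \<Rightarrow> mat2" where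
  "mat_mult (a, b, c, d) (a', b', c', d') =
     (a * a' + b * c', a * b' + b * d', c * a' + d * c', c * b' + d * d')"

text \<open>Functions w are only relevant on the upper half plane; we normalise them to be 0
  outside it so that equality of group elements is equality of the pairs.\<close>
definition Mp :: "mp_elt set" where
  "Mp = {((a, b, c, d), w). a * d - b * c = 1 \<and> w holomorphic_on uhp \<and>
           (\<forall>\<tau>\<in>uhp. (w \<tau>)^2 = of_int c * \<tau> + of_int d) \<and> (\<forall>\<tau>. \<tau> \<notin> uhp \<longrightarrow> w \<tau> = 0)}"

fun mp_mult :: "mp_elt \<Rightarrow> mp_elt \<Rightarrow> mp_elt" where
  "mp_mult (A, w) (B, v) = (mat_mult A B, \<lambda>\<tau>. w (moeb B \<tau>) * v \<tau>)"

definition mp_one :: mp_elt where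
  "mp_one = ((1, 0, 0, 1), \<lambda>\<tau>. if \<tau> \<in> uhp then 1 else 0)"

definition mp_T :: mp_elt where
  "mp_T = ((1, 1, 0, 1), \<lambda>\<tau>. if \<tau> \<in> uhp then 1 else 0)"

definition mp_S :: mp_elt where
  "mp_S = ((0, -1, 1, 0), \<lambda>\<tau>. if \<tau> \<in> uhp then csqrt \<tau> else 0)"

definition weil_action ::
  "('a::{finite,ab_group_add} \<Rightarrow> rat) \<Rightarrow> (mp_elt \<Rightarrow> ('a \<Rightarrow> complex) \<Rightarrow> ('a \<Rightarrow> complex)) \<Rightarrow> bool" where
  "weil_action Q \<rho> \<longleftrightarrow>
     (\<forall>g\<in>Mp. \<forall>u v. \<rho> g (\<lambda>x. u x + v x) = (\<lambda>x. \<rho> g u x + \<rho> g v x)) \<and>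
     (\<forall>g\<in>Mp. \<forall>c u. \<rho> g (\<lambda>x. c * u x) = (\<lambda>x. c * \<rho> g u x)) \<and>
     (\<forall>v. \<rho> mp_one v = v) \<and>
     (\<forall>g\<in>Mp. \<forall>h\<in>Mp. \<forall>v. \<rho> (mp_mult g h) v = \<rho> g (\<rho> h v)) \<and>
     \<rho> mp_T = T_op Q \<and> \<rho> mp_S = S_op Q"

definition Inv :: "(mp_elt \<Rightarrow> ('a \<Rightarrow> complex) \<Rightarrow> ('a \<Rightarrow> complex)) \<Rightarrow> ('a \<Rightarrow> complex) set" where
  "Inv \<rho> = {v. \<forall>g\<in>Mp. \<rho> g v = v}"

end

theory Submission
  imports Defs
begin

text \<open>
  If there is an isotropic subgroup \<open>U\<close> with \<open>U\<^sup>\<bottom> = U\<close>, then \<open>|M| = |U|\<^sup>2\<close>, \<open>\<sigma>(M) = 1\<close> and the indicator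
  function of \<open>U\<close> is invariant. The rank bound yields a dichotomy: either such a \<open>U\<close> exists, or
  the set of all isotropic vectors is itself a subgroup \<open>I\<close>. To see this, take \<open>U\<close> maximal among
  the isotropic subgroups orthogonal to all isotropic vectors. If some isotropic vector has maximal
  order in \<open>U\<^sup>\<bottom>/U\<close>, it generates a self-dual subgroup together with \<open>U\<close>; otherwise \<open>U\<close> could be
  enlarged unless it contains all isotropic vectors.

  In the second case \<open>I\<^sup>\<bottom> = I\<close> follows from either side of the equivalence. An invariant vector is
  supported on \<open>I\<close> by \<open>T\<close>-invariance, hence periodic under \<open>I\<^sup>\<bottom>\<close> by \<open>S\<close>-invariance, so that
  \<open>I\<^sup>\<bottom> \<subseteq> I\<close>. If \<open>|M|\<close> is a square and \<open>\<sigma>(M) = 1\<close>, the anisotropic module \<open>I\<^sup>\<bottom>/I\<close> has Gauss sum equal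
  to the square root of its order, and is of exponent \<open>p\<close> or \<open>4\<close>, where this forces it to vanish.
\<close>

section \<open>Subgroups of finite abelian groups\<close>

text \<open>Recursive form of \<open>zmult\<close> on nonnegative integers, suited to induction. In
  a finite group these multiples already include the negatives.\<close>

primrec nmul :: "nat \<Rightarrow> 'a::ab_group_add \<Rightarrow> 'a" where
  "nmul 0 x = 0"
| "nmul (Suc n) x = x + nmul n x"

lemma nmul_zero_right [simp]: "nmul n 0 = 0"
  by (induction n) auto

lemma nmul_add_left: "nmul (m + n) x = nmul m x + nmul n x"
  by (induction m) (auto simp: algebra_simps)

lemma nmul_add_right: "nmul n (x + y) = nmul n x + nmul n y"
  by (induction n) (auto simp: algebra_simps)

lemma nmul_minus_right: "nmul n (- x) = - nmul n x"
  by (induction n) (auto simp: algebra_simps)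

lemma nmul_diff_right: "nmul n (x - y) = nmul n x - nmul n y"
  using nmul_add_right[of n x "- y"] by (simp add: nmul_minus_right)

lemma nmul_mult: "nmul (m * n) x = nmul m (nmul n x)"
  by (induction m) (auto simp: nmul_add_left)

lemma nmul_commute: "nmul m (nmul n x) = nmul n (nmul m x)"
  by (metis nmul_mult mult.commute)

lemma nmul_diff_left: "n \<le> m \<Longrightarrow> nmul (m - n) x = nmul m x - nmul n x"
  using nmul_add_left[of "m - n" n x] by simp

lemma sum_const_nmul: "finite A \<Longrightarrow> (\<Sum>i\<in>A. x) = nmul (card A) x"
  by (induction A rule: finite_induct) auto

lemma zmult_int: "zmult (int n) x = nmul n x"
  by (simp add: zmult_def sum_const_nmul)

lemma zmult_minus_one: "zmult (- 1) x = - x"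
  by (simp add: zmult_def)

text \<open>Translation by \<open>x\<close> permutes the group, so the sum of all
  \<open>y + x\<close> equals the sum of all \<open>y\<close>.\<close>

lemma nmul_card [simp]:
  fixes x :: "'a::{finite,ab_group_add}"
  shows "nmul CARD('a) x = 0"
proof -
  have "(\<Sum>y\<in>UNIV. y + x) = (\<Sum>y\<in>(UNIV::'a set). y)"
    by (rule sum.reindex_bij_witness[of _ "\<lambda>y. y - x" "\<lambda>y. y + x"]) auto
  then show ?thesis
    by (simp add: sum.distrib sum_const_nmul)
qed

lemma minus_eq_nmul:
  fixes x :: "'a::{finite,ab_group_add}"
  shows "- x = nmul (CARD('a) - 1) x"
proof -
  have "Suc (CARD('a) - 1) = CARD('a)"
    by simp
  then have "x + nmul (CARD('a) - 1) x = 0"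
    by (metis nmul.simps(2) nmul_card)
  then show ?thesis
    by (simp add: minus_unique)
qed

definition subgrp :: "'a::ab_group_add set \<Rightarrow> bool" where
  "subgrp U \<longleftrightarrow> 0 \<in> U \<and> (\<forall>x\<in>U. \<forall>y\<in>U. x - y \<in> U)"

lemma subgrp_zero: "subgrp U \<Longrightarrow> 0 \<in> U"
  by (simp add: subgrp_def)

lemma subgrp_diff: "subgrp U \<Longrightarrow> x \<in> U \<Longrightarrow> y \<in> U \<Longrightarrow> x - y \<in> U"
  by (simp add: subgrp_def)

lemma subgrp_minus: "subgrp U \<Longrightarrow> x \<in> U \<Longrightarrow> - x \<in> U"
  using subgrp_diff[of U 0 x] by (simp add: subgrp_zero)

lemma subgrp_add: "subgrp U \<Longrightarrow> x \<in> U \<Longrightarrow> y \<in> U \<Longrightarrow> x + y \<in> U"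
  using subgrp_diff[of U x "- y"] by (simp add: subgrp_minus)

lemma subgrp_nmul: "subgrp U \<Longrightarrow> x \<in> U \<Longrightarrow> nmul n x \<in> U"
  by (induction n) (auto intro: subgrp_zero subgrp_add)

lemma subgrp_card_pos: "subgrp (U :: 'a::{finite,ab_group_add} set) \<Longrightarrow> card U > 0"
  using subgrp_zero by (auto simp: card_gt_0_iff)

lemma subgrp_Int: "subgrp U \<Longrightarrow> subgrp V \<Longrightarrow> subgrp (U \<inter> V)"
  by (simp add: subgrp_def)

lemma subgrp_nmul_vimage: "subgrp U \<Longrightarrow> subgrp {x. nmul n x \<in> U}"
  by (simp add: subgrp_def nmul_diff_right)

lemma subgrp_range_nmul: "subgrp (range (nmul n))"
  unfolding subgrp_def
proof (intro conjI ballI)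
  show "0 \<in> range (nmul n)"
    by (rule range_eqI[of _ _ 0]) simp
next
  fix x y :: 'a assume "x \<in> range (nmul n)" "y \<in> range (nmul n)"
  then obtain s t where "x = nmul n s" "y = nmul n t" by blast
  then have "x - y = nmul n (s - t)" by (simp add: nmul_diff_right)
  then show "x - y \<in> range (nmul n)" by blast
qed

lemma sum_subgrp_shift:
  assumes "subgrp U" "t \<in> U"
  shows "(\<Sum>x\<in>U. f (x + t)) = sum f U"
  by (rule sum.reindex_bij_witness[of _ "\<lambda>y. y - t" "\<lambda>y. y + t"])
    (use assms in \<open>auto intro: subgrp_add subgrp_diff\<close>)

text \<open>Lagrange's theorem, stated for the coset relation that underlies
  \<open>pM_quotient\<close>; each class has the form \<open>x - U\<close>.\<close>

lemma card_cosets: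
  fixes U :: "'a::{finite,ab_group_add} set"
  assumes "subgrp U"
  shows "card (UNIV // {(x, y). x - y \<in> U}) * card U = CARD('a)"
proof -
  let ?r = "{(x, y). x - y \<in> U}"
  have eq: "equiv UNIV ?r"
  proof (rule equivI)
    show "refl ?r"
      using subgrp_zero[OF assms] by (auto simp: refl_on_def)
    show "sym ?r"
    proof (rule symI)
      fix x y :: 'a
      assume "(x, y) \<in> ?r"
      then have "- (x - y) \<in> U" by (intro subgrp_minus[OF assms]) simp
      then show "(y, x) \<in> ?r" by simp
    qed
    show "trans ?r"
    proof (rule transI)
      fix x y z :: 'a
      assume "(x, y) \<in> ?r" "(y, z) \<in> ?r"
      then have "(x - y) + (y - z) \<in> U" by (intro subgrp_add[OF assms]) simp_all
      then show "(x, z) \<in> ?r" by simp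
    qed
  qed auto
  have cls: "card C = card U" if "C \<in> UNIV // ?r" for C
  proof -
    from that obtain x where "C = ?r `` {x}"
      by (rule quotientE)
    then have C: "y \<in> C \<longleftrightarrow> x - y \<in> U" for y by simp
    have "C = (\<lambda>u. x - u) ` U"
    proof (intro set_eqI iffI)
      fix y assume "y \<in> C"
      then show "y \<in> (\<lambda>u. x - u) ` U"
        unfolding C by (intro image_eqI[of _ _ "x - y"]) auto
    next
      fix y assume "y \<in> (\<lambda>u. x - u) ` U"
      then obtain u where "u \<in> U" "y = x - u" by (rule imageE)
      then show "y \<in> C" unfolding C by simp
    qed
    then show ?thesis
      by (simp add: card_image inj_on_def)
  qed
  have "card U * card (UNIV // ?r) = card (\<Union> (UNIV // ?r))"
    by (rule card_partition) (use cls quotient_disj[OF eq] in auto)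
  also have "\<Union> (UNIV // ?r) = UNIV"
    by (rule Union_quotient[OF eq])
  finally show "card (UNIV // ?r) * card U = CARD('a)"
    by (simp add: mult.commute)
qed

section \<open>Enlarging a subgroup by one element\<close>

definition adjoin :: "'a::ab_group_add set \<Rightarrow> 'a \<Rightarrow> 'a set" where
  "adjoin U z = {u + nmul n z | u n. u \<in> U}"

lemma subgrp_adjoin:
  fixes U :: "'a::{finite,ab_group_add} set"
  assumes "subgrp U"
  shows "subgrp (adjoin U z)"
  unfolding subgrp_def
proof (intro conjI ballI)
  show "0 \<in> adjoin U z"
    unfolding adjoin_def using subgrp_zero[OF assms] by (auto intro!: exI[of _ 0])
next
  fix x y assume "x \<in> adjoin U z" "y \<in> adjoin U z"
  then obtain u m v n where *: "u \<in> U" "x = u + nmul m z" "v \<in> U" "y = v + nmul n z"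
    unfolding adjoin_def by blast
  have "x - y = (u - v) + (nmul m z + - nmul n z)"
    using * by simp
  also have "- nmul n z = nmul ((CARD('a) - 1) * n) z"
    by (subst minus_eq_nmul) (simp add: nmul_mult)
  finally have "x - y = (u - v) + nmul (m + (CARD('a) - 1) * n) z"
    by (simp add: nmul_add_left)
  then show "x - y \<in> adjoin U z"
    unfolding adjoin_def using * subgrp_diff[OF assms] by blast
qed

lemma adjoin_superset: "U \<subseteq> adjoin U z"
proof
  fix u assume "u \<in> U"
  then have "u + nmul 0 z \<in> adjoin U z"
    unfolding adjoin_def by blast
  then show "u \<in> adjoin U z"
    by simp
qed

lemma adjoin_mem: "subgrp U \<Longrightarrow> z \<in> adjoin U z"
  unfolding adjoin_def by (auto intro!: exI[of _ 0] exI[of _ "Suc 0"] dest: subgrp_zero)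

lemma adjoin_least: "subgrp S \<Longrightarrow> U \<subseteq> S \<Longrightarrow> z \<in> S \<Longrightarrow> adjoin U z \<subseteq> S"
  unfolding adjoin_def by (auto intro: subgrp_add subgrp_nmul)

text \<open>The hypotheses say that \<open>z\<close> has order exactly \<open>p ^ Suc c\<close>
  modulo \<open>U\<close>, so the cosets of its first \<open>p ^ Suc c\<close> multiples are
  distinct. A coincidence would put a multiple \<open>d\<close> of \<open>z\<close> with
  \<open>0 < d < p ^ Suc c\<close> into \<open>U\<close>; then \<open>gcd d (p ^ Suc c)\<close> is a
  power of \<open>p\<close> dividing \<open>p ^ c\<close>.\<close>

lemma card_adjoin:
  fixes U :: "'a::{finite,ab_group_add} set"
  assumes "subgrp U" "prime p" "nmul (p ^ c) z \<notin> U" "nmul (p ^ Suc c) z \<in> U"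
  shows "card (adjoin U z) \<ge> p ^ Suc c * card U"
proof -
  have key: False if "m < n" "n < p ^ Suc c" "nmul n z - nmul m z \<in> U" for m n
  proof -
    define d where "d = n - m"
    have d: "0 < d" "d < p ^ Suc c" "nmul d z \<in> U"
      using that by (auto simp: d_def nmul_diff_left)
    obtain x y where xy: "d * x = p ^ Suc c * y + gcd d (p ^ Suc c)"
      using bezout_nat[of d "p ^ Suc c"] d(1) by auto
    have "nmul (gcd d (p ^ Suc c)) z = nmul (x * d) z - nmul (y * p ^ Suc c) z"
      using arg_cong[OF xy, of "\<lambda>k. nmul k z"] by (simp add: nmul_add_left mult.commute)
    also have "\<dots> \<in> U"
      unfolding nmul_mult by (intro subgrp_diff subgrp_nmul assms d)
    finally have g: "nmul (gcd d (p ^ Suc c)) z \<in> U" .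
    obtain i where i: "i \<le> Suc c" "gcd d (p ^ Suc c) = p ^ i"
      using divides_primepow_nat[OF assms(2)] gcd_dvd2 by metis
    have "gcd d (p ^ Suc c) \<le> d"
      using d(1) by (simp add: gcd_le1_nat)
    then have "i \<noteq> Suc c"
      using i d(2) by auto
    then have "p ^ c = p ^ (c - i) * p ^ i"
      using i by (simp flip: power_add)
    then have "nmul (p ^ c) z \<in> U"
      using g i by (simp add: nmul_mult subgrp_nmul[OF assms(1)])
    then show False
      using assms by simp
  qed
  have "inj_on (\<lambda>(n, u). u + nmul n z) ({..<p ^ Suc c} \<times> U)"
  proof (rule inj_onI)
    fix s t
    assume st: "s \<in> {..<p ^ Suc c} \<times> U" "t \<in> {..<p ^ Suc c} \<times> U"
      and st_eq: "(\<lambda>(n, u). u + nmul n z) s = (\<lambda>(n, u). u + nmul n z) t"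
    obtain n u m v where nm: "s = (n, u)" "t = (m, v)"
      by fastforce
    have *: "n < p ^ Suc c" "u \<in> U" "m < p ^ Suc c" "v \<in> U"
      and eq: "u + nmul n z = v + nmul m z"
      using st st_eq by (auto simp: nm)
    have e1: "nmul n z - nmul m z = v - u"
      using eq by (simp add: algebra_simps)
    have e2: "nmul m z - nmul n z = u - v"
      using eq by (simp add: algebra_simps)
    have "n = m"
      using key[of n m] key[of m n] * e1 e2 subgrp_diff[OF assms(1)]
      by (metis linorder_neqE_nat)
    then show "s = t"
      using eq nm by simp
  qed
  then have "card ((\<lambda>(n, u). u + nmul n z) ` ({..<p ^ Suc c} \<times> U)) = p ^ Suc c * card U"
    by (simp add: card_image card_cartesian_product)
  moreover have "(\<lambda>(n, u). u + nmul n z) ` ({..<p ^ Suc c} \<times> U) \<subseteq> adjoin U z"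
    unfolding adjoin_def by auto
  ultimately show ?thesis
    by (metis card_mono finite)
qed

section \<open>Counting by torsion\<close>

lemma card_le_card_image_torsion:
  fixes K U :: "'a::{finite,ab_group_add} set"
  assumes "\<And>x. x \<in> K \<Longrightarrow> nmul n x \<in> U"
  shows "card K \<le> card U * card {x :: 'a. nmul n x = 0}"
proof -
  \<comment> \<open>A nonempty fibre of multiplication by \<open>n\<close> is moved into the
    \<open>n\<close>-torsion by subtracting one of its points.\<close>
  have fib: "card {x \<in> K. nmul n x = u} \<le> card {x :: 'a. nmul n x = 0}" for u
  proof (cases "{x \<in> K. nmul n x = u} = {}")
    case False
    then obtain x0 where x0: "x0 \<in> K" "nmul n x0 = u" by auto
    have "inj_on (\<lambda>x. x - x0) {x \<in> K. nmul n x = u}"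
      by (auto intro: inj_onI)
    then show ?thesis
      by (rule card_inj_on_le) (use x0 in \<open>auto simp: nmul_diff_right\<close>)
  next
    case True
    then show ?thesis by (metis card.empty zero_le)
  qed
  have "K = (\<Union>u\<in>U. {x \<in> K. nmul n x = u})"
    using assms by auto
  then have "card K \<le> (\<Sum>u\<in>U. card {x \<in> K. nmul n x = u})"
    by (metis card_UN_le finite)
  also have "\<dots> \<le> (\<Sum>u\<in>U. card {x :: 'a. nmul n x = 0})"
    by (rule sum_mono) (rule fib)
  finally show ?thesis by simp
qed

lemma card_torsion_power:
  "card {x :: 'a::{finite,ab_group_add}. nmul (p ^ m) x = 0} \<le> card {x :: 'a. nmul p x = 0} ^ m"
proof (induction m)
  case 0
  have "{x :: 'a. nmul (p ^ 0) x = 0} = {0}" by auto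
  then show ?case by simp
next
  case (Suc m)
  have "card {x :: 'a. nmul (p ^ Suc m) x = 0}
      \<le> card {x :: 'a. nmul (p ^ m) x = 0} * card {x :: 'a. nmul p x = 0}"
    by (rule card_le_card_image_torsion) (simp add: nmul_mult flip: nmul_commute[of p])
  also have "\<dots> \<le> card {x :: 'a. nmul p x = 0} ^ m * card {x :: 'a. nmul p x = 0}"
    using Suc.IH by simp
  finally show ?case by (simp add: mult.commute)
qed

section \<open>Quadratic modules in multiplicative notation\<close>

text \<open>Models \<open>e(Q)\<close> and \<open>e(B)\<close>: congruences modulo the integers
  become equations between complex numbers of norm 1. Evenness of \<open>q\<close> together with
  bilinearity yields the full law for multiples in \<open>q_nmul\<close>.\<close>

locale quadratic_character =
  fixes q :: "'a::{finite,ab_group_add} \<Rightarrow> complex"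
    and b :: "'a \<Rightarrow> 'a \<Rightarrow> complex"
  assumes q_add: "q (x + y) = q x * q y * b x y"
    and b_add_left: "b (x + y) z = b x z * b y z"
    and q_minus [simp]: "q (- x) = q x"
    and norm_q [simp]: "norm (q x) = 1"
    and nondeg: "(\<And>y. b x y = 1) \<Longrightarrow> x = 0"
begin

definition isotropic :: "'a set" where
  "isotropic = {x. q x = 1}"

definition perp :: "'a set \<Rightarrow> 'a set" where
  "perp U = {x. \<forall>u\<in>U. b x u = 1}"

lemma q_nonzero [simp]: "q x \<noteq> 0"
  using norm_q[of x] by (metis norm_zero zero_neq_one)

lemma b_eq: "b x y = q (x + y) / (q x * q y)"
  by (simp add: q_add)

lemma b_commute: "b x y = b y x"
  by (simp add: b_eq add.commute mult.commute)

lemma b_nonzero [simp]: "b x y \<noteq> 0"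
  by (simp add: b_eq)

lemma b_add_right: "b x (y + z) = b x y * b x z"
  using b_add_left[of y z x] by (simp add: b_commute)

lemma b_zero_left [simp]: "b 0 y = 1"
  using b_add_left[of 0 0 y] by simp

lemma b_zero_right [simp]: "b x 0 = 1"
  by (simp add: b_commute[of x])

lemma q_zero [simp]: "q 0 = 1"
  using q_add[of 0 0] by simp

lemma b_minus_left: "b (- x) y = inverse (b x y)"
  using b_add_left[of x "- x" y] by (simp add: inverse_unique)

lemma b_minus_right: "b x (- y) = inverse (b x y)"
  using b_minus_left[of y x] by (simp add: b_commute)

lemma b_diff_left: "b (x - y) z = b x z / b y z"
  using b_add_left[of x "- y" z] by (simp add: b_minus_left divide_inverse)

lemma b_self: "b x x = q x ^ 2"
proof -
  have "1 = q x * q x * inverse (b x x)"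
    using q_add[of x "- x"] by (simp add: b_minus_right)
  then show ?thesis
    by (simp add: field_simps power2_eq_square)
qed

lemma b_nmul_left: "b (nmul n x) y = b x y ^ n"
  by (induction n) (simp_all add: b_add_left)

lemma b_nmul_right: "b x (nmul n y) = b x y ^ n"
  by (simp add: b_commute[of x] b_nmul_left)

lemma q_nmul: "q (nmul n x) = q x ^ (n ^ 2)"
proof (induction n)
  case (Suc n)
  have "q (nmul (Suc n) x) = q x * q x ^ (n ^ 2) * (q x ^ 2) ^ n"
    by (simp add: q_add Suc.IH b_nmul_right b_self)
  also have "\<dots> = q x ^ (1 + n ^ 2 + 2 * n)"
    by (simp add: power_add power_mult)
  also have "1 + n ^ 2 + 2 * n = Suc n ^ 2"
    by (simp add: power2_eq_square)
  finally show ?case .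
qed simp

section \<open>Orthogonal complements and character sums\<close>

lemma subgrp_perp [simp]: "subgrp (perp U)"
  by (simp add: subgrp_def perp_def b_diff_left)

lemma perpD: "x \<in> perp U \<Longrightarrow> u \<in> U \<Longrightarrow> b x u = 1"
  by (simp add: perp_def)

lemma perpD': "x \<in> perp U \<Longrightarrow> u \<in> U \<Longrightarrow> b u x = 1"
  by (simp add: perp_def b_commute)

text \<open>Orthogonality of characters: if \<open>b x t\<close> differs from 1 for some
  \<open>t\<close> in \<open>U\<close>, translating by \<open>t\<close> multiplies the sum by
  \<open>b x t\<close>, so it vanishes.\<close>

lemma sum_b:
  assumes "subgrp U"
  shows "(\<Sum>u\<in>U. b x u) = (if x \<in> perp U then of_nat (card U) else 0)"
proof (cases "x \<in> perp U")
  case True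
  then show ?thesis by (simp add: perp_def)
next
  case False
  then obtain t where t: "t \<in> U" "b x t \<noteq> 1"
    by (auto simp: perp_def)
  have "(\<Sum>u\<in>U. b x u) = (\<Sum>u\<in>U. b x (u + t))"
    by (simp add: sum_subgrp_shift[OF assms t(1)])
  also have "\<dots> = (\<Sum>u\<in>U. b x u) * b x t"
    by (simp add: b_add_right sum_distrib_right)
  finally have "(\<Sum>u\<in>U. b x u) = 0"
    using t(2) by simp
  then show ?thesis using False by simp
qed

lemma perp_UNIV: "perp UNIV = {0}"
  using nondeg by (auto simp: perp_def)

text \<open>Double counting of \<open>b x u\<close> over all \<open>x\<close> and all
  \<open>u\<close> in \<open>U\<close>: summing over \<open>u\<close> first leaves
  \<open>perp U\<close>, summing over \<open>x\<close> first leaves only \<open>u = 0\<close> by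
  nondegeneracy.\<close>

lemma card_perp:
  assumes "subgrp U"
  shows "card U * card (perp U) = CARD('a)"
proof -
  have "of_nat (card U * card (perp U)) = (\<Sum>x\<in>UNIV. if x \<in> perp U then of_nat (card U) else (0::complex))"
    by (simp add: sum.If_cases)
  also have "\<dots> = (\<Sum>x\<in>UNIV. \<Sum>u\<in>U. b x u)"
    by (simp add: sum_b[OF assms])
  also have "\<dots> = (\<Sum>u\<in>U. \<Sum>x\<in>UNIV. b u x)"
    by (subst sum.swap) (simp add: b_commute)
  also have "\<dots> = (\<Sum>u\<in>U. if u = 0 then of_nat CARD('a) else 0)"
    by (intro sum.cong refl) (simp add: sum_b[of UNIV] subgrp_def perp_UNIV)
  also have "\<dots> = of_nat CARD('a)"
    using subgrp_zero[OF assms] by (simp add: sum.delta)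
  finally show ?thesis
    by (simp only: of_nat_eq_iff)
qed

lemma perp_perp:
  assumes "subgrp U"
  shows "perp (perp U) = U"
proof -
  have "U \<subseteq> perp (perp U)"
    by (auto simp: perp_def b_commute)
  moreover have "card (perp (perp U)) = card U"
    using card_perp[OF assms] card_perp[of "perp U"] subgrp_card_pos[OF subgrp_perp, of U]
    by (metis mult.commute mult_cancel1 not_gr_zero subgrp_perp)
  ultimately show ?thesis
    by (metis card_subset_eq finite)
qed

lemma card_subgrp_power:
  fixes U :: "'a set"
  assumes "prime p" "CARD('a) = p ^ k" "subgrp U"
  obtains s where "card U = p ^ s"
  using card_perp[OF assms(3)] assms(1,2) divides_primepow_nat by (metis dvd_triv_left)

lemma isotropic_perp:
  fixes U :: "'a set"
  assumes "subgrp U" "U \<subseteq> isotropic"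
  shows "U \<subseteq> perp U"
proof -
  have "q x = 1" if "x \<in> U" for x
    using assms(2) that by (auto simp: isotropic_def)
  then show ?thesis
    using subgrp_add[OF assms(1)] by (auto simp: perp_def b_eq)
qed

lemma adjoin_isotropic:
  assumes "U \<subseteq> isotropic" "z \<in> perp U" "z \<in> isotropic"
  shows "adjoin U z \<subseteq> isotropic"
  using assms
  by (auto simp: adjoin_def isotropic_def q_add q_nmul b_nmul_right perpD')

lemma perp_adjoin:
  assumes "y \<in> perp U" "b y z = 1"
  shows "y \<in> perp (adjoin U z)"
  using assms by (auto simp: adjoin_def perp_def b_add_right b_nmul_right)

text \<open>Averaging over an isotropic subgroup kills everything outside its orthogonal complement.\<close>

lemma sum_q_perp:
  assumes "subgrp U" "U \<subseteq> isotropic"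
  shows "(\<Sum>x\<in>UNIV. q x) = (\<Sum>x\<in>perp U. q x)"
proof -
  have "of_nat (card U) * (\<Sum>x\<in>UNIV. q x) = (\<Sum>u\<in>U. \<Sum>x\<in>UNIV. q (x + u))"
    using sum_subgrp_shift[of UNIV _ q] by (simp add: subgrp_def)
  also have "\<dots> = (\<Sum>u\<in>U. \<Sum>x\<in>UNIV. q x * b x u)"
    using assms(2) by (intro sum.cong refl) (auto simp: q_add isotropic_def)
  also have "\<dots> = (\<Sum>x\<in>UNIV. q x * (\<Sum>u\<in>U. b x u))"
    by (subst sum.swap) (simp add: sum_distrib_left)
  also have "\<dots> = (\<Sum>x\<in>UNIV. if x \<in> perp U then of_nat (card U) * q x else 0)"
    by (intro sum.cong refl) (simp add: sum_b[OF assms(1)])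
  also have "\<dots> = of_nat (card U) * (\<Sum>x\<in>perp U. q x)"
    by (simp add: sum.If_cases sum_distrib_left)
  finally show ?thesis
    using subgrp_card_pos[OF assms(1)]
    by (metis mult_left_cancel not_gr_zero of_nat_eq_0_iff)
qed

lemma self_dual_sum_q:
  assumes "subgrp U" "U \<subseteq> isotropic" "perp U = U"
  shows "(\<Sum>x\<in>UNIV. q x) = of_nat (card U)"
proof -
  have "(\<Sum>x\<in>U. q x) = (\<Sum>x\<in>U. 1)"
    using assms(2) by (intro sum.cong refl) (auto simp: isotropic_def)
  then show ?thesis
    by (simp add: sum_q_perp[OF assms(1,2)] assms(3))
qed

text \<open>Since \<open>nmul (p ^ Suc c) h\<close> lies in \<open>U\<close>, the order of \<open>q h\<close> divides \<open>2 * p ^ Suc c\<close>, whereas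
  \<open>q (nmul (p ^ c) h)\<close> is the \<open>p ^ (2 * c)\<close>-th power of \<open>q h\<close>.\<close>

lemma top_multiple_anisotropic:
  assumes "prime p" "h \<in> perp U" "U \<subseteq> isotropic" "nmul (p ^ Suc c) h \<in> U"
    and "q (nmul (p ^ c) h) \<noteq> 1"
  shows "c = 0 \<or> p = 2 \<and> c = 1"
proof (rule ccontr)
  assume contr: "\<not> (c = 0 \<or> p = 2 \<and> c = 1)"
  then have c: "c \<ge> 1" by simp
  have r2: "q h ^ (2 * p ^ Suc c) = 1"
    using perpD[OF assms(2,4)] by (simp only: b_nmul_right b_self power_mult)
  have rp: "q h ^ ((p ^ Suc c) ^ 2) = 1"
    using assms(3,4) by (auto simp: isotropic_def simp flip: q_nmul)
  have qw: "q (nmul (p ^ c) h) = q h ^ (p ^ (2 * c))"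
    by (simp add: q_nmul mult.commute flip: power_mult)
  show False
  proof (cases "p = 2")
    case True
    \<comment> \<open>For \<open>p = 2\<close> the left side is \<open>2 ^ (c + 2)\<close>, and here
      \<open>c \<ge> 2\<close>.\<close>
    have "2 * p ^ Suc c dvd p ^ (2 * c)"
      using True contr c by (simp flip: power_Suc add: le_imp_power_dvd)
    then show False
      using assms(5) qw r2 by (metis dvdE power_mult power_one)
  next
    case False
    then have "odd p"
      using assms(1) prime_odd_nat prime_ge_2_nat by (metis le_neq_implies_less)
    then have "odd (p ^ Suc c)" by simp
    then obtain m where m: "p ^ Suc c = 2 * m + 1"
      by (rule oddE)
    \<comment> \<open>For odd \<open>p\<close> the factor 2 in the order drops out: both the square
      and an odd power of \<open>r\<close> are 1.\<close>
    define r where "r = q h ^ (p ^ Suc c)"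
    have r: "r ^ 2 = 1" "r ^ (p ^ Suc c) = 1"
      using r2 rp unfolding r_def power2_eq_square[of "p ^ Suc c"]
      by (metis power_mult mult.commute, metis power_mult)
    then have "r = 1"
      unfolding m by (simp add: power_mult)
    moreover have "p ^ Suc c dvd p ^ (2 * c)"
      using c by (intro le_imp_power_dvd) simp
    ultimately show False
      using assms(5) qw unfolding r_def by (metis dvdE power_mult power_one)
  qed
qed

section \<open>Orders modulo a subgroup and the dichotomy\<close>

lemma exponent_mod:
  assumes "CARD('a) = p ^ k" "subgrp U" "\<not> perp U \<subseteq> U"
  obtains c h where "\<And>x. x \<in> perp U \<Longrightarrow> nmul (p ^ Suc c) x \<in> U"
    and "h \<in> perp U" "nmul (p ^ c) h \<notin> U"
proof -
  define P where "P = (\<lambda>j. \<forall>x\<in>perp U. nmul (p ^ j) x \<in> U)"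
  have "P k"
    using subgrp_zero[OF assms(2)] by (auto simp: P_def simp flip: assms(1))
  then have L: "P (LEAST j. P j)" by (rule LeastI)
  \<comment> \<open>The least exponent is positive, hence of the form \<open>Suc c\<close>; its
    minimality supplies the element \<open>h\<close> of maximal order.\<close>
  have "\<not> P 0"
    using assms(3) by (auto simp: P_def)
  then obtain c where c: "(LEAST j. P j) = Suc c"
    using L by (metis not0_implies_Suc)
  then have "\<not> P c"
    by (metis lessI not_less_Least)
  then show thesis
    using that[of c] L unfolding c unfolding P_def by blast
qed

text \<open>The last of \<open>z0\<close>, \<open>p z0\<close>, \<open>p^2 z0\<close>, ... lying
  outside \<open>U\<close> has order \<open>p\<close> modulo \<open>U\<close>.\<close>

lemma exists_prime_order_mod:
  fixes U :: "'a set"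
  assumes "CARD('a) = p ^ k" "subgrp U" "z0 \<notin> U"
  obtains j where "nmul (p ^ j) z0 \<notin> U" "nmul p (nmul (p ^ j) z0) \<in> U"
proof -
  define P where "P = (\<lambda>j. nmul (p ^ j) z0 \<in> U)"
  have "P k"
    using subgrp_zero[OF assms(2)] by (auto simp: P_def simp flip: assms(1))
  then have L: "P (LEAST j. P j)" by (rule LeastI)
  have "\<not> P 0"
    using assms(3) by (auto simp: P_def)
  then obtain c where c: "(LEAST j. P j) = Suc c"
    using L by (metis not0_implies_Suc)
  then have "\<not> P c"
    by (metis lessI not_less_Least)
  then show thesis
    using that[of c] L unfolding c unfolding P_def by (simp add: nmul_mult)
qed

lemma card_le_torsion:
  fixes K U :: "'a set"
  assumes "card {x :: 'a. nmul p x = 0} \<le> p ^ 2" "\<And>x. x \<in> K \<Longrightarrow> nmul (p ^ m) x \<in> U"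
  shows "card K \<le> card U * p ^ (2 * m)"
proof -
  have "card K \<le> card U * card {x :: 'a. nmul (p ^ m) x = 0}"
    by (rule card_le_card_image_torsion) (rule assms(2))
  also have "card {x :: 'a. nmul (p ^ m) x = 0} \<le> (p ^ 2) ^ m"
    by (rule order_trans[OF card_torsion_power power_mono]) (use assms in auto)
  finally show ?thesis
    by (simp add: power_mult)
qed

text \<open>The rank bound limits the index of \<open>U\<close> in \<open>perp U\<close> to the square of the order of \<open>y\<close> modulo \<open>U\<close>.\<close>

lemma self_dual_adjoin:
  assumes "prime p" "card {x :: 'a. nmul p x = 0} \<le> p ^ 2"
    and "subgrp U" "U \<subseteq> isotropic"
    and "\<And>x. x \<in> perp U \<Longrightarrow> nmul (p ^ Suc c) x \<in> U"
    and "y \<in> perp U" "y \<in> isotropic" "nmul (p ^ c) y \<notin> U"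
  shows "perp (adjoin U y) = adjoin U y"
proof -
  let ?V = "adjoin U y"
  have V: "subgrp ?V" "?V \<subseteq> isotropic"
    using subgrp_adjoin adjoin_isotropic assms by blast+
  have le: "p ^ Suc c * card U \<le> card ?V"
    by (rule card_adjoin) (use assms in auto)
  have "card (perp U) \<le> card U * p ^ (2 * Suc c)"
    by (rule card_le_torsion) (use assms in auto)
  \<comment> \<open>The left side is the order of the module, which also equals
    \<open>card ?V * card (perp ?V)\<close>; the right side is at most
    \<open>card ?V ^ 2\<close>.\<close>
  then have "card U * card (perp U) \<le> card U * (card U * p ^ (2 * Suc c))"
    by (rule mult_le_mono2)
  also have "card U * (card U * p ^ (2 * Suc c)) = (p ^ Suc c * card U) ^ 2"
    by (simp add: power2_eq_square power_mult power_mult_distrib mult_2 power_add)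
  also have "\<dots> \<le> card ?V ^ 2"
    using le by (rule power_mono) simp
  finally have "card ?V * card (perp ?V) \<le> card ?V * card ?V"
    by (simp add: card_perp V assms power2_eq_square)
  then have "card (perp ?V) \<le> card ?V"
    using subgrp_card_pos[OF V(1)] by simp
  with isotropic_perp[OF V] show ?thesis
    by (metis card_seteq finite)
qed

theorem self_dual_or_isotropic_subgrp:
  assumes p: "prime p" and k: "CARD('a) = p ^ k"
    and tors: "card {x :: 'a. nmul p x = 0} \<le> p ^ 2"
  shows "(\<exists>U. subgrp U \<and> U \<subseteq> isotropic \<and> perp U = U) \<or> subgrp isotropic"
proof -
  define F where "F = {U. subgrp U \<and> U \<subseteq> isotropic \<and> isotropic \<subseteq> perp U}"
  have "{0} \<in> F"
    by (auto simp: F_def subgrp_def isotropic_def perp_def)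
  then obtain U where U: "U \<in> F" and max: "\<And>V. V \<in> F \<Longrightarrow> card V \<le> card U"
    \<comment> \<open>The successor makes the bound on cardinalities strict, as the rule
      requires.\<close>
    using ex_has_greatest_nat[of "\<lambda>V. V \<in> F" "{0}" card "Suc CARD('a)"]
      card_mono[of "UNIV :: 'a set"] by (auto simp: less_Suc_eq_le)
  have sU: "subgrp U" and iU: "U \<subseteq> isotropic" and Up: "isotropic \<subseteq> perp U"
    using U by (auto simp: F_def)
  show ?thesis
  proof (cases "isotropic \<subseteq> U")
    case True
    then show ?thesis using sU iU by (metis subset_antisym)
  next
    case False
    then obtain z0 where z0: "z0 \<in> isotropic" "z0 \<notin> U" by blast
    obtain j where j: "nmul (p ^ j) z0 \<notin> U" "nmul p (nmul (p ^ j) z0) \<in> U"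
      using exists_prime_order_mod[OF k sU z0(2)] by blast
    define z where "z = nmul (p ^ j) z0"
    have z: "z \<in> isotropic" "z \<in> perp U" "z \<notin> U" "nmul p z \<in> U"
      using z0 Up j by (auto simp: z_def isotropic_def q_nmul)
    then have "\<not> perp U \<subseteq> U" by blast
    from exponent_mod[OF k sU this] obtain c h
      where ex: "\<And>x. x \<in> perp U \<Longrightarrow> nmul (p ^ Suc c) x \<in> U"
        and h: "h \<in> perp U" "nmul (p ^ c) h \<notin> U"
      by blast
    show ?thesis
    proof (cases "\<exists>y\<in>isotropic. nmul (p ^ c) y \<notin> U")
      case True
      then obtain y where y: "y \<in> isotropic" "nmul (p ^ c) y \<notin> U" by blast
      have "perp (adjoin U y) = adjoin U y"
        by (rule self_dual_adjoin) (use p tors sU iU ex y Up in auto)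
      then show ?thesis
        using subgrp_adjoin[OF sU, of y] adjoin_isotropic[OF iU, of y] y Up by blast
    next
      case False
      then have top: "nmul (p ^ c) y \<in> U" if "y \<in> isotropic" for y
        using that by blast
      \<comment> \<open>Otherwise adjoining \<open>x\<close> to \<open>U\<close> would give a larger
        member of \<open>F\<close>.\<close>
      have not_orth: "\<exists>y\<in>isotropic. b y x \<noteq> 1" if x: "x \<in> isotropic" "x \<notin> U" for x
      proof (rule ccontr)
        assume "\<not> ?thesis"
        then have "adjoin U x \<in> F"
          using subgrp_adjoin[OF sU, of x] adjoin_isotropic[OF iU, of x] x Up
          by (auto simp: F_def intro!: perp_adjoin)
        then have "card (adjoin U x) \<le> card U" by (rule max)
        then show False
          using adjoin_superset[of U x] adjoin_mem[OF sU, of x] x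
          by (metis card_seteq finite)
      qed
      define w where "w = nmul (p ^ c) h"
      have w: "w \<notin> U" "w \<in> perp U"
        using h by (auto simp: w_def subgrp_nmul)
      \<comment> \<open>The factor \<open>p ^ c\<close> moves from \<open>h\<close> to
        \<open>y\<close>, where it lands in \<open>U\<close>. Being orthogonal to all isotropic
        vectors and outside \<open>U\<close>, \<open>w\<close> cannot be isotropic itself.\<close>
      have bw: "b y w = 1" if "y \<in> isotropic" for y
        using perpD'[OF h(1) top[OF that]] by (simp add: w_def b_nmul_left b_nmul_right)
      then have "w \<notin> isotropic"
        using not_orth w by blast
      then have qw: "q (nmul (p ^ c) h) \<noteq> 1"
        by (simp add: w_def isotropic_def)
      have "c \<noteq> 0"
        using top[OF z(1)] z(3) by (cases c) auto
      then have pc: "p = 2" "c = 1"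
        using top_multiple_anisotropic[OF p h(1) iU ex[OF h(1)] qw] by auto
      obtain y where y: "y \<in> isotropic" "b y z \<noteq> 1"
        using not_orth z by blast
      \<comment> \<open>The rank bound allows at most \<open>p ^ 2\<close> cosets of
        \<open>U\<close> in \<open>K\<close>. Already \<open>z\<close> and \<open>w\<close> account
        for that many, all orthogonal to \<open>z\<close>; \<open>y\<close> also lies in
        \<open>K\<close>, because \<open>c = 1\<close>, but is not orthogonal to
        \<open>z\<close>.\<close>
      define K where "K = perp U \<inter> {x. nmul p x \<in> U}"
      have K: "card K \<le> card U * p ^ 2"
        using card_le_torsion[OF tors, of K 1 U] by (simp add: K_def)
      have yK: "y \<in> K"
        using top[OF y(1)] y Up by (auto simp: K_def pc)
      let ?V = "adjoin U z" and ?W = "adjoin (adjoin U z) w"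
      have V: "subgrp ?V" "?V \<subseteq> isotropic"
        using subgrp_adjoin[OF sU] adjoin_isotropic[OF iU] z by auto
      have pw: "nmul p w \<in> U"
        using ex[OF h(1)] by (simp add: w_def nmul_mult)
      have cV: "p * card U \<le> card ?V"
        using card_adjoin[of U p 0 z] sU p z by simp
      \<comment> \<open>\<open>?V\<close> is isotropic, whereas \<open>w\<close> is not.\<close>
      have "w \<notin> ?V"
        using V(2) qw by (auto simp: w_def isotropic_def)
      moreover have "nmul p w \<in> ?V"
        using pw adjoin_superset by blast
      ultimately have "p * card ?V \<le> card ?W"
        using card_adjoin[of ?V p 0 w] V p by simp
      with cV have cW: "card U * p ^ 2 \<le> card ?W"
        by (metis mult.assoc mult.commute mult_le_mono2 order_trans power2_eq_square)
      have "b w z = 1"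
        using bw[OF z(1)] by (simp add: b_commute)
      moreover have "b z z = 1"
        using z(1) by (simp add: b_self isotropic_def)
      ultimately have "?W \<subseteq> K \<inter> perp {z}"
        using z w pw isotropic_perp[OF sU iU] sU
        by (intro adjoin_least)
          (auto simp: K_def intro!: subgrp_Int subgrp_nmul_vimage subgrp_nmul,
           auto simp: perp_def b_commute)
      then have "insert y ?W \<subseteq> K" "y \<notin> ?W"
        using yK y(2) by (auto simp: perp_def)
      then have "card ?W < card K"
        by (metis card_seteq finite insert_subset not_less)
      then show ?thesis
        using K cW by simp
    qed
  qed
qed

end

section \<open>Sums of complex numbers of norm 1\<close>

lemma Re_fourth_root_le_0:
  fixes z :: complex
  assumes "z ^ 4 = 1" "z \<noteq> 1"
  shows "Re z \<le> 0"
proof -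
  have "(z - 1) * (z + 1) * (z - \<i>) * (z + \<i>) = z ^ 4 - 1"
    by (simp add: algebra_simps power4_eq_xxxx)
  then have "z + 1 = 0 \<or> z - \<i> = 0 \<or> z + \<i> = 0"
    using assms by simp
  then show ?thesis
    by (auto simp: complex_eq_iff)
qed

lemma sum_powers_root_of_unity:
  fixes z :: complex
  assumes "z ^ p = 1"
  shows "(\<Sum>a<p. z ^ a) = (if z = 1 then of_nat p else 0)"
  using assms by (simp add: sum_gp_strict)

text \<open>Equality case of the triangle inequality: the defects \<open>1 - Re (f x)\<close> are
  nonnegative with nonpositive sum, so all of them vanish.\<close>

lemma eq_one_if_Re_sum_ge:
  fixes f :: "'b \<Rightarrow> complex"
  assumes "finite A" "\<And>x. x \<in> A \<Longrightarrow> norm (f x) = 1" "real (card A) \<le> Re (sum f A)" "a \<in> A"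
  shows "f a = 1"
proof -
  have le: "Re (f x) \<le> 1" if "x \<in> A" for x
    using complex_Re_le_cmod[of "f x"] assms(2)[OF that] by simp
  have "(\<Sum>x\<in>A. 1 - Re (f x)) \<le> 0"
    using assms(3) by (simp add: sum_subtractf)
  moreover have "(\<Sum>x\<in>A. 1 - Re (f x)) \<ge> 0"
    using le by (intro sum_nonneg) auto
  ultimately have "\<forall>x\<in>A. 1 - Re (f x) = 0"
    using sum_nonneg_eq_0_iff[OF assms(1), of "\<lambda>x. 1 - Re (f x)"] le by force
  then have "Re (f a) = 1"
    using assms(4) by auto
  then show ?thesis
    using cmod_power2[of "f a"] assms(2)[OF assms(4)] by (simp add: complex_eq_iff)
qed

section \<open>Gauss sums on the orthogonal complement\<close>

context quadratic_character
begin

text \<open>Substituting \<open>x = d + y\<close> in the squared norm turns the sum over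
  \<open>y\<close> into a character sum over \<open>perp U\<close>. It survives only if
  \<open>nmul a d\<close> lies in \<open>perp (perp U) = U\<close>, hence only for \<open>d\<close>
  in \<open>U\<close>, where \<open>q d = 1\<close>.\<close>

lemma norm_gauss_sum:
  assumes "subgrp U" "U \<subseteq> isotropic"
    and "\<And>d. d \<in> perp U \<Longrightarrow> nmul a d \<in> U \<Longrightarrow> d \<in> U"
  shows "(norm (\<Sum>x\<in>perp U. q x ^ a))\<^sup>2 = real (card (perp U) * card U)"
proof -
  let ?H = "perp U"
  have cnj_q: "q y * cnj (q y) = 1" for y
    by (simp add: complex_norm_square[symmetric])
  have "of_real ((norm (\<Sum>x\<in>?H. q x ^ a))\<^sup>2)
      = (\<Sum>x\<in>?H. \<Sum>y\<in>?H. q x ^ a * cnj (q y ^ a))"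
    unfolding complex_norm_square cnj_sum sum_product ..
  also have "\<dots> = (\<Sum>y\<in>?H. \<Sum>x\<in>?H. q x ^ a * cnj (q y ^ a))"
    by (rule sum.swap)
  also have "\<dots> = (\<Sum>y\<in>?H. \<Sum>d\<in>?H. q (d + y) ^ a * cnj (q y ^ a))"
    by (intro sum.cong refl sum_subgrp_shift[symmetric] subgrp_perp)
  also have "\<dots> = (\<Sum>y\<in>?H. \<Sum>d\<in>?H. q d ^ a * b (nmul a d) y)"
  proof (intro sum.cong refl)
    fix y d
    have "q (d + y) ^ a * cnj (q y ^ a) = q d ^ a * b d y ^ a * (q y * cnj (q y)) ^ a"
      by (simp add: q_add power_mult_distrib)
    then show "q (d + y) ^ a * cnj (q y ^ a) = q d ^ a * b (nmul a d) y"
      by (simp add: cnj_q b_nmul_left)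
  qed
  also have "\<dots> = (\<Sum>d\<in>?H. q d ^ a * (\<Sum>y\<in>?H. b (nmul a d) y))"
    by (subst sum.swap) (simp add: sum_distrib_left)
  also have "\<dots> = (\<Sum>d\<in>?H. if d \<in> U then of_nat (card ?H) else 0)"
  proof (intro sum.cong refl)
    fix d assume d: "d \<in> ?H"
    have "nmul a d \<in> U \<longleftrightarrow> d \<in> U"
      using assms(3)[OF d] subgrp_nmul[OF assms(1)] by blast
    then show "q d ^ a * (\<Sum>y\<in>?H. b (nmul a d) y) = (if d \<in> U then of_nat (card ?H) else 0)"
      using assms(2) by (auto simp: sum_b perp_perp[OF assms(1)] isotropic_def)
  qed
  also have "\<dots> = of_nat (card ?H * card U)"
    using isotropic_perp[OF assms(1,2)] by (simp add: sum.If_cases Int_absorb1)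
  finally show ?thesis
    by (metis of_real_eq_iff of_real_of_nat_eq)
qed

text \<open>The Gauss sums of all multiples \<open>a q\<close> with \<open>0 < a < p\<close> have the same absolute value and
  add up to minus the sum of these absolute values, so none of them is positive.\<close>

lemma Re_gauss_sum_odd:
  assumes "prime p" "U \<subseteq> isotropic" "subgrp U"
    and "\<And>x. x \<in> perp U \<Longrightarrow> nmul p x \<in> U" "\<And>x. x \<in> perp U \<Longrightarrow> q x ^ p = 1"
    and "perp U \<inter> isotropic = U" "card (perp U) = p ^ 2 * card U"
  shows "Re (\<Sum>x\<in>perp U. q x) \<le> - real (p * card U)"
proof -
  let ?H = "perp U" and ?u = "real (card U)"
  define G where "G = (\<lambda>a. \<Sum>x\<in>?H. q x ^ a)"
  have p2: "p \<ge> 2" using assms(1) by (rule prime_ge_2_nat)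
  have nG: "norm (G a) = real p * ?u" if a: "a \<in> {1..<p}" for a
  proof -
    have "coprime a p"
      using a assms(1) by (metis atLeastLessThan_iff coprime_commute dvd_imp_le not_le not_one_le_zero
          prime_imp_coprime gr0I)
    have "d \<in> U" if d: "d \<in> ?H" "nmul a d \<in> U" for d
    proof -
      \<comment> \<open>\<open>x\<close> inverts \<open>a\<close> modulo \<open>p\<close>, and
        \<open>p\<close> annihilates \<open>perp U\<close> modulo \<open>U\<close>.\<close>
      obtain x y where xy: "a * x = p * y + 1"
        using bezout_nat[of a p] a \<open>coprime a p\<close> by auto
      have "nmul (a * x) d = nmul (p * y) d + nmul 1 d"
        unfolding xy by (rule nmul_add_left)
      then have "d = nmul (x * a) d - nmul (y * p) d"
        by (simp add: mult.commute)
      also have "\<dots> \<in> U"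
        unfolding nmul_mult by (intro subgrp_diff subgrp_nmul assms d)
      finally show ?thesis .
    qed
    then have "(norm (G a))\<^sup>2 = (real p * ?u)\<^sup>2"
      unfolding G_def using norm_gauss_sum[OF assms(3,2)] assms(7)
      by (simp add: power2_eq_square)
    then show ?thesis
      by simp
  qed
  have "(\<Sum>a<p. G a) = (\<Sum>x\<in>?H. \<Sum>a<p. q x ^ a)"
    unfolding G_def by (rule sum.swap)
  also have "\<dots> = (\<Sum>x\<in>?H. if x \<in> isotropic then of_nat p else 0)"
    by (intro sum.cong refl) (simp add: sum_powers_root_of_unity assms(5) isotropic_def)
  also have "\<dots> = of_nat (p * card U)"
    using assms(6) by (simp add: sum.If_cases)
  finally have "Re (\<Sum>a<p. G a) = real p * ?u"
    by simp
  \<comment> \<open>The term \<open>a = 0\<close> is the order of \<open>perp U\<close>. Bounding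
    the other \<open>p - 2\<close> terms below by \<open>- (p * card U)\<close> leaves the claimed
    bound for \<open>a = 1\<close>.\<close>
  moreover have "{..<p} = insert 0 (insert 1 {2..<p})"
    using p2 by auto
  ultimately have "Re (G 0) + Re (G 1) + (\<Sum>a\<in>{2..<p}. Re (G a)) = real p * ?u"
    by simp
  moreover have "Re (G 0) = real p ^ 2 * ?u"
    by (simp add: G_def assms(7))
  moreover have "(\<Sum>a\<in>{2..<p}. Re (G a)) \<ge> (\<Sum>a\<in>{2..<p}. - (real p * ?u))"
  proof (rule sum_mono)
    fix a assume "a \<in> {2..<p}"
    then show "- (real p * ?u) \<le> Re (G a)"
      using nG[of a] abs_Re_le_cmod[of "G a"] by auto
  qed
  ultimately have "Re (G 1) \<le> real p * ?u - real p ^ 2 * ?u + (real p - 2) * (real p * ?u)"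
    using p2 by (simp add: of_nat_diff)
  then show ?thesis
    by (simp add: G_def algebra_simps power2_eq_square)
qed

theorem isotropic_subgrp_self_dual:
  assumes p: "prime p" and k: "CARD('a) = p ^ k"
    and tors: "card {x :: 'a. nmul p x = 0} \<le> p ^ 2"
    and sU: "subgrp isotropic"
    and square: "CARD('a) = n ^ 2"
    and gauss: "(\<Sum>x\<in>UNIV. q x) = of_nat n"
  shows "perp isotropic = isotropic"
proof (rule ccontr)
  assume contr: "perp isotropic \<noteq> isotropic"
  define U where "U = isotropic"
  let ?H = "perp U"
  note sU = sU[folded U_def]
  have iU: "U \<subseteq> isotropic" by (simp add: U_def)
  have UH: "U \<subseteq> ?H" using isotropic_perp sU iU .
  have nH: "\<not> ?H \<subseteq> U" using contr UH by (auto simp: U_def)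
  have UI: "x \<in> U \<longleftrightarrow> q x = 1" for x by (simp add: U_def isotropic_def)
  have gH: "(\<Sum>x\<in>?H. q x) = of_nat n"
    using gauss sum_q_perp[OF sU iU] by simp
  have UHn: "card U * card ?H = n ^ 2"
    using card_perp[OF sU] square by simp
  have lt: "card U < card ?H"
    using UH nH by (metis finite psubsetI psubset_card_mono subset_refl)
  obtain s t where st: "card U = p ^ s" "card ?H = p ^ t"
    using card_subgrp_power[OF p k] sU subgrp_perp by metis
  obtain m where m: "n = p ^ m"
    using k square p by (metis divides_primepow_nat dvd_triv_left power2_eq_square)
  have p1: "p > 1" using p by (rule prime_gt_1_nat)
  have stm: "s + t = 2 * m"
    using UHn p1 unfolding st m by (simp flip: power_add power_mult)
  have s_lt_t: "s < t"
    using lt p1 unfolding st by simp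
  from exponent_mod[OF k sU nH] obtain c h
    where ex: "\<And>x. x \<in> ?H \<Longrightarrow> nmul (p ^ Suc c) x \<in> U"
      and h: "h \<in> ?H" "nmul (p ^ c) h \<notin> U"
    by blast
  have "c = 0 \<or> p = 2 \<and> c = 1"
    using top_multiple_anisotropic[OF p h(1) iU ex[OF h(1)]] h(2) by (simp add: UI)
  then consider "c = 0" "p = 2" | "c = 0" "p \<noteq> 2" | "c = 1" "p = 2" by blast
  then show False
  proof cases
    case 1
    \<comment> \<open>Exponent 2: the values of \<open>q\<close> are fourth roots of unity, so
      vectors outside \<open>U\<close> contribute nonpositive real parts. The sum is then at most
      \<open>card U\<close>, which is less than \<open>n\<close>.\<close>
    have "Re (\<Sum>x\<in>?H. q x) = (\<Sum>x\<in>U. Re (q x)) + (\<Sum>x\<in>?H - U. Re (q x))"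
      using sum.subset_diff[OF UH, of "\<lambda>x. Re (q x)"] by simp
    also have "(\<Sum>x\<in>U. Re (q x)) = (\<Sum>x\<in>U. 1)"
      by (intro sum.cong refl) (simp add: UI)
    also have "(\<Sum>x\<in>?H - U. Re (q x)) \<le> 0"
    proof (intro sum_nonpos Re_fourth_root_le_0)
      fix x assume x: "x \<in> ?H - U"
      then show "q x \<noteq> 1" by (simp add: UI)
      show "q x ^ 4 = 1"
        using ex[of x] x 1 by (simp add: UI q_nmul del: nmul.simps(2))
    qed
    finally have "n \<le> card U"
      using gH by simp
    then have "n ^ 2 \<le> card U * card U"
      by (simp add: power2_eq_square mult_le_mono)
    also have "\<dots> < card U * card ?H"
      using lt subgrp_card_pos[OF sU] by simp
    finally show False
      using UHn by simp
  next
    case 2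
    have odd: "odd p"
      using p 2 prime_odd_nat prime_ge_2_nat by (metis le_neq_implies_less)
    \<comment> \<open>By the rank bound \<open>t - s\<close> is at most 2; it is positive and even,
      hence equal to 2.\<close>
    have "card ?H \<le> card U * p ^ 2"
      using card_le_torsion[OF tors, of ?H 1 U] ex 2 by simp
    then have "p ^ t \<le> p ^ (s + 2)"
      unfolding st by (simp only: power_add)
    then have "t \<le> s + 2"
      using p1 by (simp only: power_le_imp_le_exp)
    then have t: "t = s + 2" "m = s + 1"
      using s_lt_t stm by presburger+
    have qp: "q x ^ p = 1" if x: "x \<in> ?H" for x
    proof -
      have px: "nmul p x \<in> U" using ex[OF x] 2 by simp
      define r where "r = q x ^ p"
      have "r ^ p = 1"
        using px by (simp add: UI q_nmul r_def power2_eq_square power_mult)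
      moreover have "r ^ 2 = 1"
        using perpD[OF x px] unfolding r_def b_nmul_right b_self by (metis power_mult mult.commute)
      moreover obtain j where "p = 2 * j + 1" using odd by (rule oddE)
      ultimately show ?thesis
        unfolding r_def[symmetric] by (simp add: power_mult)
    qed
    have "Re (\<Sum>x\<in>?H. q x) \<le> - real (p * card U)"
    proof (rule Re_gauss_sum_odd[OF p iU sU])
      show "nmul p x \<in> U" if "x \<in> ?H" for x
        using ex[OF that] 2 by simp
      show "?H \<inter> isotropic = U" using UH by (auto simp: U_def)
      show "card ?H = p ^ 2 * card U"
        by (simp only: st t power_add mult.commute)
    qed (rule qp)
    then have "real n \<le> - real (p * card U)"
      by (simp add: gH)
    moreover have "p * card U > 0"
      using p1 subgrp_card_pos[OF sU] by simp
    ultimately show False by linarith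
  next
    case 3
    define w where "w = nmul 2 h"
    have w: "w \<in> ?H" "w \<notin> U"
      using h 3 by (auto simp: w_def subgrp_nmul)
    have four: "nmul 4 x \<in> U" if "x \<in> ?H" for x
      using ex[OF that] 3 by (simp del: nmul.simps(2))
    have double: "nmul 2 (nmul 2 x) = nmul 4 x" for x :: 'a
      by (simp flip: nmul_mult)
    \<comment> \<open>Exponent 4: outside \<open>K\<close> every double has \<open>q\<close>-value
      -1, so the difference of two such doubles is isotropic. Hence \<open>?H - K\<close> is
      contained in \<open>h + K\<close>, and \<open>K\<close> makes up at least half of
      \<open>?H\<close>.\<close>
    define K where "K = ?H \<inter> {x. nmul 2 x \<in> U}"
    have sK: "subgrp K"
      unfolding K_def by (intro subgrp_Int subgrp_perp subgrp_nmul_vimage sU)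
    have q2: "q (nmul 2 x) = -1" if x: "x \<in> ?H" "x \<notin> K" for x
    proof -
      have "q (nmul 2 x) ^ 2 = b x (nmul 4 x)"
        by (simp add: q_nmul b_nmul_right b_self flip: power_mult)
      also have "\<dots> = 1" using perpD[OF x(1) four[OF x(1)]] .
      finally show ?thesis
        using x by (auto simp: K_def UI power2_eq_1_iff)
    qed
    have hK: "h \<notin> K" using w by (simp add: K_def w_def)
    have wK: "w \<in> K" using w four[OF h(1)] by (simp add: K_def w_def double)
    have diff: "x - h \<in> K" if x: "x \<in> ?H" "x \<notin> K" for x
    proof -
      have "b (nmul 2 x) (nmul 2 h) = 1"
        using perpD[OF x(1) four[OF h(1)]] by (simp add: b_nmul_left b_nmul_right flip: power_mult)
      then have "q (nmul 2 x + - nmul 2 h) = 1"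
        unfolding q_add by (simp add: b_minus_right q2 x h hK)
      then show ?thesis
        using x h by (simp add: K_def UI nmul_diff_right subgrp_diff)
    qed
    have cHK: "card (?H - K) \<le> card K"
      by (rule card_inj_on_le[where f = "\<lambda>x. x - h"]) (auto intro: inj_onI diff)
    have cH: "card ?H = card K + card (?H - K)"
      by (subst card_Un_disjoint[symmetric]) (auto simp: K_def intro: arg_cong[of _ _ card])
    have "card K \<le> card U * p ^ 2"
      using card_le_torsion[OF tors, of K 1 U] 3 by (simp add: K_def)
    then have "card ?H \<le> card U * 8"
      using cH cHK 3 by simp
    then have "2 ^ t \<le> (2 ^ (s + 3) :: nat)"
      using 3 unfolding st by (simp add: power_add)
    then have t3: "t \<le> s + 3"
      by simp
    have UK: "U \<subseteq> K"
      using UH by (auto simp: K_def intro: subgrp_nmul[OF sU])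
    have "nmul 2 w \<in> U"
      using wK by (simp add: K_def)
    \<comment> \<open>With \<open>K\<close> a proper subset of \<open>?H\<close>, this gives
      \<open>t > s + 1\<close>; since \<open>t \<le> s + 3\<close> and \<open>s + t\<close> is even,
      \<open>t = s + 2\<close>.\<close>
    then have "2 * card U \<le> card (adjoin U w)"
      using card_adjoin[of U 2 0 w] sU w by simp
    also have "\<dots> \<le> card K"
      by (intro card_mono adjoin_least sK UK wK) simp
    finally have K2: "2 * card U \<le> card K" .
    have "card K < card ?H"
      using h hK by (intro psubset_card_mono) (auto simp: K_def)
    then have "2 ^ (s + 1) < (2 ^ t :: nat)"
      using K2 3 unfolding st by simp
    then have "s + 1 < t"
      by (rule power_less_imp_less_exp[rotated]) simp
    then have t: "t = s + 2" "m = s + 1"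
      using t3 stm by presburger+
    have n: "n = 2 * card U" "card ?H = 4 * card U"
      by (simp_all add: m st t 3)
    \<comment> \<open>Translation by \<open>w\<close> negates \<open>q\<close> on \<open>K\<close>,
      so \<open>K\<close> contributes nothing. The at most \<open>n\<close> terms of
      \<open>?H - K\<close> must then add up to \<open>n\<close>, which forces each to be 1,
      including \<open>q h\<close>.\<close>
    have "(\<Sum>x\<in>K. q x) = (\<Sum>x\<in>K. q (x + w))"
      by (rule sum_subgrp_shift[OF sK wK, symmetric])
    also have "\<dots> = (\<Sum>x\<in>K. - q x)"
    proof (intro sum.cong refl)
      fix x assume x: "x \<in> K"
      have "b x w = b (nmul 2 x) h"
        by (simp add: w_def b_nmul_left b_nmul_right)
      also have "\<dots> = 1"
        using x perpD'[OF h(1)] by (simp add: K_def)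
      finally show "q (x + w) = - q x"
        using q2[OF h(1) hK] by (simp add: q_add w_def)
    qed
    finally have "(\<Sum>x\<in>K. q x) = 0"
      by (simp add: sum_negf)
    moreover have "(\<Sum>x\<in>?H. q x) = (\<Sum>x\<in>?H - K. q x) + (\<Sum>x\<in>K. q x)"
      by (rule sum.subset_diff) (auto simp: K_def)
    ultimately have "(\<Sum>x\<in>?H - K. q x) = of_nat n"
      using gH by simp
    then have "q h = 1"
      using n K2 cH h hK by (intro eq_one_if_Re_sum_ge[of "?H - K"]) auto
    then have "h \<in> U" by (simp add: UI)
    then show False
      using h(2) subgrp_nmul[OF sU] by blast
  qed
qed

end

section \<open>The metaplectic group\<close>

text \<open>Right multiplication by \<open>T^n\<close> in closed form, for integers \<open>n\<close>
  of either sign.\<close>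

fun mp_shift :: "int \<Rightarrow> mp_elt \<Rightarrow> mp_elt" where
  "mp_shift n ((a, b, c, d), w) =
     ((a, a * n + b, c, c * n + d), \<lambda>\<tau>. if \<tau> \<in> uhp then w (\<tau> + of_int n) else 0)"

fun mp_flip :: "mp_elt \<Rightarrow> mp_elt" where
  "mp_flip ((a, b, c, d), w) =
     ((b, - a, d, - c), \<lambda>\<tau>. if \<tau> \<in> uhp then w (- 1 / \<tau>) * csqrt \<tau> else 0)"

lemma mp_elt_cases:
  obtains a b c d w where "(g :: mp_elt) = ((a, b, c, d), w)"
  by (cases g) auto

lemma uhp_add_int [simp]: "\<tau> + of_int n \<in> uhp \<longleftrightarrow> \<tau> \<in> uhp"
  by (simp add: uhp_def)

lemma uhp_nonzero: "\<tau> \<in> uhp \<Longrightarrow> \<tau> \<noteq> 0"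
  by (auto simp: uhp_def)

lemma uhp_minus_inverse: "\<tau> \<in> uhp \<Longrightarrow> - 1 / \<tau> \<in> uhp"
  by (auto simp: uhp_def Im_divide intro!: divide_pos_pos add_nonneg_pos)

lemma csqrt_holomorphic_uhp: "csqrt holomorphic_on uhp"
  by (rule holomorphic_on_subset[OF holomorphic_on_csqrt]) (auto simp: uhp_def complex_nonpos_Reals_iff)

lemma mp_mult_T: "mp_mult g mp_T = mp_shift 1 g"
  by (cases g rule: mp_elt_cases) (auto simp: mp_T_def)

lemma mp_mult_S: "mp_mult g mp_S = mp_flip g"
  by (cases g rule: mp_elt_cases) (auto simp: mp_S_def)

lemma mp_T_in_Mp: "mp_T \<in> Mp"
  by (auto simp: mp_T_def Mp_def intro: holomorphic_transform[of "\<lambda>_. 1"])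

lemma mp_S_in_Mp: "mp_S \<in> Mp"
  by (auto simp: mp_S_def Mp_def intro: holomorphic_transform[OF csqrt_holomorphic_uhp])

lemma mp_shift_in_Mp:
  assumes "g \<in> Mp"
  shows "mp_shift n g \<in> Mp"
proof -
  obtain a b c d w where g: "g = ((a, b, c, d), w)"
    by (cases g rule: mp_elt_cases)
  have w: "w holomorphic_on uhp" "\<And>\<tau>. \<tau> \<in> uhp \<Longrightarrow> (w \<tau>)\<^sup>2 = of_int c * \<tau> + of_int d"
    and det: "a * d - b * c = 1"
    using assms by (auto simp: Mp_def g)
  have "(w \<circ> (\<lambda>\<tau>. \<tau> + of_int n)) holomorphic_on uhp"
    by (rule holomorphic_on_compose_gen[OF _ w(1)]) (auto intro!: holomorphic_intros)
  then have "(\<lambda>\<tau>. if \<tau> \<in> uhp then w (\<tau> + of_int n) else 0) holomorphic_on uhp"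
    by (rule holomorphic_transform) auto
  then show ?thesis
    using det by (auto simp: g Mp_def w(2) algebra_simps)
qed

lemma mp_flip_in_Mp:
  assumes "g \<in> Mp"
  shows "mp_flip g \<in> Mp"
proof -
  obtain a b c d w where g: "g = ((a, b, c, d), w)"
    by (cases g rule: mp_elt_cases)
  have w: "w holomorphic_on uhp" "\<And>\<tau>. \<tau> \<in> uhp \<Longrightarrow> (w \<tau>)\<^sup>2 = of_int c * \<tau> + of_int d"
    and det: "a * d - b * c = 1"
    using assms by (auto simp: Mp_def g)
  have "(w \<circ> (\<lambda>\<tau>. - 1 / \<tau>)) holomorphic_on uhp"
    by (rule holomorphic_on_compose_gen[OF _ w(1)])
      (auto intro!: holomorphic_intros uhp_minus_inverse[simplified] dest: uhp_nonzero)
  then have "(\<lambda>\<tau>. (w \<circ> (\<lambda>\<tau>. - 1 / \<tau>)) \<tau> * csqrt \<tau>) holomorphic_on uhp"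
    by (intro holomorphic_on_mult csqrt_holomorphic_uhp)
  then have "(\<lambda>\<tau>. if \<tau> \<in> uhp then w (- 1 / \<tau>) * csqrt \<tau> else 0) holomorphic_on uhp"
    by (rule holomorphic_transform) auto
  moreover have "(w (- 1 / \<tau>) * csqrt \<tau>)\<^sup>2 = of_int d * \<tau> + of_int (- c)" if "\<tau> \<in> uhp" for \<tau>
    using w(2)[OF uhp_minus_inverse[OF that]] uhp_nonzero[OF that]
    by (simp add: power_mult_distrib field_simps)
  ultimately show ?thesis
    using det by (auto simp: g Mp_def algebra_simps)
qed

lemma mp_shift_add: "mp_shift m (mp_shift n g) = mp_shift (m + n) g"
  by (cases g rule: mp_elt_cases) (auto simp: algebra_simps fun_eq_iff)

lemma mp_shift_0:
  assumes "g \<in> Mp"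
  shows "mp_shift 0 g = g"
  using assms by (cases g rule: mp_elt_cases) (auto simp: Mp_def fun_eq_iff)

text \<open>The root \<open>s\<close> of \<open>\<tau>\<close> lies in the upper half plane, so
  \<open>\<i> / s\<close> has positive real part and is the principal root of
  \<open>- 1 / \<tau>\<close>.\<close>

lemma csqrt_minus_inverse:
  assumes "\<tau> \<in> uhp"
  shows "csqrt (- 1 / \<tau>) * csqrt \<tau> = \<i>"
proof -
  define s where "s = csqrt \<tau>"
  have s2: "s\<^sup>2 = \<tau>" and Re: "Re s \<ge> 0"
    using csqrt_principal[of \<tau>] by (auto simp: s_def)
  have "2 * Re s * Im s > 0"
    using assms unfolding uhp_def s2[symmetric] by (simp add: power2_eq_square)
  then have Im: "Im s > 0"
    using Re by (simp add: zero_less_mult_iff)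
  then have s0: "s \<noteq> 0" by auto
  have "csqrt (- 1 / \<tau>) = \<i> / s"
  proof (rule csqrt_unique)
    show "(\<i> / s)\<^sup>2 = - 1 / \<tau>"
      by (simp add: power_divide s2)
    have "Re (\<i> / s) > 0"
      using Im s0 by (auto simp: Re_divide intro!: divide_pos_pos add_nonneg_pos)
    then show "0 < Re (\<i> / s) \<or> Re (\<i> / s) = 0 \<and> 0 \<le> Im (\<i> / s)" ..
  qed
  then show ?thesis
    using s0 by (simp flip: s_def)
qed

text \<open>Says that \<open>S^2 = (-I, \<i>)\<close>. Consequently \<open>S^4 = (I, -1)\<close>,
  the nontrivial element over the identity matrix.\<close>

lemma mp_flip_flip:
  "mp_flip (mp_flip ((a, b, c, d), w)) =
    ((- a, - b, - c, - d), \<lambda>\<tau>. if \<tau> \<in> uhp then \<i> * w \<tau> else 0)"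
proof -
  have "w \<tau> * csqrt (- 1 / \<tau>) * csqrt \<tau> = \<i> * w \<tau>" if "\<tau> \<in> uhp" for \<tau>
    using csqrt_minus_inverse[OF that] by (metis mult.assoc mult.commute)
  then show ?thesis
    using uhp_minus_inverse by (auto simp: fun_eq_iff)
qed

text \<open>A continuous function with values 1 and -1 is constant on the connected half plane; thus
  only two elements of \<open>Mp\<close> lie over the identity matrix.\<close>

lemma uhp_root_of_one:
  assumes "w holomorphic_on uhp" "\<And>\<tau>. \<tau> \<in> uhp \<Longrightarrow> (w \<tau>)\<^sup>2 = 1"
  obtains e where "e = 1 \<or> e = -1" "\<And>\<tau>. \<tau> \<in> uhp \<Longrightarrow> w \<tau> = e"
proof -
  have range: "w \<tau> \<in> {1, -1}" if "\<tau> \<in> uhp" for \<tau>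
    using assms(2)[OF that] by (simp add: power2_eq_1_iff)
  have "connected uhp"
    unfolding uhp_def by (intro convex_connected convex_halfspace_Im_gt)
  then have "w constant_on uhp"
    by (rule continuous_finite_range_constant)
      (use assms(1) range in \<open>auto intro!: holomorphic_on_imp_continuous_on finite_subset[of _ "{1, -1}"]\<close>)
  then obtain e where e: "\<And>\<tau>. \<tau> \<in> uhp \<Longrightarrow> w \<tau> = e"
    unfolding constant_on_def by blast
  have "\<i> \<in> uhp" by (simp add: uhp_def)
  then have "e = 1 \<or> e = -1"
    using range e by force
  then show thesis
    using that e by blast
qed

text \<open>Right multiplication by \<open>T\<^sup>n\<close> and \<open>S\<close> does not change the image of a vector fixed by
  both, and runs the Euclidean algorithm on the lower row of the matrix.\<close>

lemma Mp_fixed: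
  assumes mult: "\<And>g h. g \<in> Mp \<Longrightarrow> h \<in> Mp \<Longrightarrow> \<rho> (mp_mult g h) v = \<rho> g (\<rho> h v)"
    and one: "\<rho> mp_one v = v" and T: "\<rho> mp_T v = v" and S: "\<rho> mp_S v = v"
    and "g \<in> Mp"
  shows "\<rho> g v = v"
proof -
  have flip: "\<rho> (mp_flip g) v = \<rho> g v" if "g \<in> Mp" for g
    using mult[OF that mp_S_in_Mp] S by (simp add: mp_mult_S)
  have shift1: "\<rho> (mp_shift 1 g) v = \<rho> g v" if "g \<in> Mp" for g
    using mult[OF that mp_T_in_Mp] T by (simp add: mp_mult_T)
  have shift_nat: "\<rho> (mp_shift (int k) g) v = \<rho> g v" if "g \<in> Mp" for g k
  proof (induction k)
    case 0
    then show ?case by (simp add: mp_shift_0 that)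
  next
    case (Suc k)
    then show ?case
      using shift1[OF mp_shift_in_Mp[OF that, of "int k"]] by (simp add: mp_shift_add add.commute)
  qed
  have shift: "\<rho> (mp_shift n g) v = \<rho> g v" if "g \<in> Mp" for g n
  proof (cases "n \<ge> 0")
    case True
    then show ?thesis using shift_nat[OF that, of "nat n"] by simp
  next
    case False
    have "\<rho> (mp_shift (int (nat (- n))) (mp_shift n g)) v = \<rho> (mp_shift n g) v"
      by (rule shift_nat) (rule mp_shift_in_Mp[OF that])
    then show ?thesis
      using False by (simp add: mp_shift_add mp_shift_0 that)
  qed
  have unipotent: "\<rho> ((1, b, 0, 1), w) v = v" if "((1, b, 0, 1), w) \<in> Mp" for b w
  proof -
    \<comment> \<open>The shift clears the upper right entry.\<close>
    define g where "g = mp_shift (- b) ((1, b, 0, 1), w)"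
    have gM: "g \<in> Mp" and \<rho>g: "\<rho> g v = \<rho> ((1, b, 0, 1), w) v"
      unfolding g_def by (rule mp_shift_in_Mp[OF that], rule shift[OF that])
    obtain u where g: "g = ((1, 0, 0, 1), u)"
      by (simp add: g_def)
    have u: "u holomorphic_on uhp" "\<And>\<tau>. \<tau> \<in> uhp \<Longrightarrow> (u \<tau>)\<^sup>2 = 1" "\<And>\<tau>. \<tau> \<notin> uhp \<Longrightarrow> u \<tau> = 0"
      using gM by (auto simp: g Mp_def)
    obtain e where e: "e = 1 \<or> e = -1" "\<And>\<tau>. \<tau> \<in> uhp \<Longrightarrow> u \<tau> = e"
      using uhp_root_of_one[OF u(1,2)] by blast
    from e(1) have "\<rho> g v = v"
    proof
      assume "e = 1"
      then have "g = mp_one"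
        using e(2) u(3) by (auto simp: g mp_one_def fun_eq_iff)
      then show ?thesis by (simp add: one)
    next
      assume "e = -1"
      \<comment> \<open>Four flips multiply by \<open>S^4\<close>, which cancels the sign of
        \<open>u\<close>.\<close>
      then have "mp_flip (mp_flip (mp_flip (mp_flip g))) = mp_one"
        using e(2) u(3) by (simp only: g mp_flip_flip) (auto simp: mp_one_def fun_eq_iff)
      then show ?thesis
        using one gM by (metis flip mp_flip_in_Mp)
    qed
    then show ?thesis by (simp add: \<rho>g)
  qed
  have "\<rho> ((a, b, c, d), w) v = v" if "((a, b, c, d), w) \<in> Mp" for a b c d w
    using that
  proof (induction "nat \<bar>c\<bar>" arbitrary: a b c d w rule: less_induct)
    case less
    let ?g = "((a, b, c, d), w)"
    show ?case
    proof (cases "c = 0")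
      case True
      then have "a * d = 1"
        using less.prems by (auto simp: Mp_def)
      then consider "a = 1" "d = 1" | "a = -1" "d = -1"
        by (auto simp: zmult_eq_1_iff)
      then show ?thesis
      proof cases
        case 1
        then show ?thesis using unipotent less.prems True by simp
      next
        case 2
        have "mp_flip (mp_flip ?g) \<in> Mp"
          by (intro mp_flip_in_Mp less.prems)
        then have "\<rho> (mp_flip (mp_flip ?g)) v = v"
          unfolding mp_flip_flip using 2 True unipotent by simp
        then show ?thesis
          using flip mp_flip_in_Mp less.prems by metis
      qed
    next
      case False
      \<comment> \<open>One Euclidean step: the shift replaces \<open>d\<close> by
        \<open>d mod c\<close>, and the flip moves that remainder into the lower left
        corner.\<close>
      define h where "h = mp_flip (mp_shift (- (d div c)) ?g)"
      have hM: "h \<in> Mp"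
        unfolding h_def by (intro mp_flip_in_Mp mp_shift_in_Mp less.prems)
      have \<rho>h: "\<rho> h v = \<rho> ?g v"
        unfolding h_def using flip shift mp_shift_in_Mp less.prems by metis
      have "c * - (d div c) + d = d mod c"
        by (simp add: minus_mult_div_eq_mod[symmetric])
      then obtain a' b' w' where h: "h = ((a', b', d mod c, - c), w')"
        by (simp add: h_def)
      have "nat \<bar>d mod c\<bar> < nat \<bar>c\<bar>"
        using False by (simp add: abs_mod_less)
      then have "\<rho> h v = v"
        using less.hyps hM unfolding h by blast
      then show ?thesis by (simp add: \<rho>h)
    qed
  qed
  then show ?thesis
    using assms(5) by (cases g rule: mp_elt_cases) auto
qed

section \<open>Invariants of the Weil representation\<close>

lemma ee_real: "ee t = exp (\<i> * of_real (2 * pi * of_rat t))"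
proof -
  have "(of_rat t :: complex) = of_real (of_rat t)"
    by (cases t) (simp add: of_rat_rat)
  then show ?thesis
    by (simp add: ee_def mult_ac)
qed

lemma ee_add: "ee (s + t) = ee s * ee t"
  by (simp add: ee_def of_rat_add distrib_left exp_add)

lemma ee_minus: "ee (- t) = cnj (ee t)"
  by (simp add: ee_real of_rat_minus exp_cnj)

lemma norm_ee: "norm (ee t) = 1"
  unfolding ee_real by (rule norm_exp_i_times)

lemma ee_eq_1_iff: "ee t = 1 \<longleftrightarrow> t \<in> \<int>"
proof
  assume "ee t = 1"
  then obtain n :: int where "2 * pi * of_rat t = of_int (2 * n) * pi"
    by (auto simp: ee_real exp_eq_1)
  then have "(of_rat t :: real) = of_rat (of_int n)"
    by simp
  then show "t \<in> \<int>"
    by (simp only: of_rat_eq_iff Ints_of_int)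
next
  assume "t \<in> \<int>"
  then obtain n where "t = of_int n" by (rule Ints_cases)
  then show "ee t = 1"
    by (auto simp: ee_real exp_eq_1 intro!: exI[of _ n])
qed

lemma ee_cong: "s - t \<in> \<int> \<Longrightarrow> ee s = ee t"
  using ee_add[of "s - t" t] by (simp add: ee_eq_1_iff[symmetric])

lemma quadratic_character_ee:
  fixes Q :: "'a::{finite,ab_group_add} \<Rightarrow> rat"
  assumes "is_fqm Q" "nondegenerate Q"
  shows "quadratic_character (\<lambda>x. ee (Q x)) (\<lambda>x y. ee (Bf Q x y))"
proof
  fix x y z :: 'a
  show "ee (Q (x + y)) = ee (Q x) * ee (Q y) * ee (Bf Q x y)"
    by (simp add: Bf_def flip: ee_add)
  have "Bf Q (x + y) z - (Bf Q x z + Bf Q y z) \<in> \<int>"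
    using assms(1) by (simp add: is_fqm_def diff_diff_eq)
  then show "ee (Bf Q (x + y) z) = ee (Bf Q x z) * ee (Bf Q y z)"
    by (simp add: ee_cong flip: ee_add)
  have "Q (zmult (- 1) x) - of_int ((- 1)\<^sup>2) * Q x \<in> \<int>"
    using assms(1) unfolding is_fqm_def by blast
  then show "ee (Q (- x)) = ee (Q x)"
    by (simp add: zmult_minus_one ee_cong)
  show "norm (ee (Q x)) = 1"
    by (rule norm_ee)
  show "x = 0" if "\<And>y. ee (Bf Q x y) = 1"
    using that assms(2) by (simp add: ee_eq_1_iff nondegenerate_def)
qed

lemma card_pM_quotient:
  "card (pM_quotient p :: 'a::{finite,ab_group_add} set set) * card (range (nmul p) :: 'a set) = CARD('a)"
proof -
  have "zmult (int p) = (nmul p :: 'a \<Rightarrow> 'a)"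
    by (rule ext) (rule zmult_int)
  then show ?thesis
    using card_cosets[OF subgrp_range_nmul[of p, where 'a = 'a]] by (simp add: pM_quotient_def)
qed

text \<open>Multiplication by \<open>p\<close> is self-adjoint for \<open>b\<close>, so by
  nondegeneracy its kernel is the orthogonal complement of its image.\<close>

lemma (in quadratic_character) card_torsion:
  "card (range (nmul p) :: 'a set) * card {x :: 'a. nmul p x = 0} = CARD('a)"
proof -
  have "b x (nmul p y) = b (nmul p x) y" for x y
    by (simp add: b_nmul_left b_nmul_right)
  then have "perp (range (nmul p)) = {x. nmul p x = 0}"
    using nondeg by (auto simp: perp_def)
  then show ?thesis
    using card_perp[OF subgrp_range_nmul, of p] by simp
qed

text \<open>The \<open>p\<close>-torsion and \<open>M/pM\<close> both have order equal to the index
  of \<open>pM\<close>, which is a power of \<open>p\<close>; so the description in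
  \<open>fp_dim\<close> determines a unique exponent.\<close>

lemma (in quadratic_character) card_torsion_fp_dim:
  assumes "prime p" "CARD('a) = p ^ k"
  shows "card {x :: 'a. nmul p x = 0} = p ^ fp_dim p TYPE('a)"
proof -
  let ?C = "card (pM_quotient p :: 'a set set)"
  have "card (range (nmul p) :: 'a set) > 0"
    by (simp add: card_gt_0_iff)
  then have eq: "card {x :: 'a. nmul p x = 0} = ?C"
    using card_torsion[of p] card_pM_quotient[of p, where 'a = 'a]
    by (metis mult.commute mult_left_cancel not_gr_zero)
  have "?C dvd p ^ k"
    using card_pM_quotient[of p, where 'a = 'a] assms(2) by (metis dvd_triv_left)
  then obtain d where d: "?C = p ^ d"
    using divides_primepow_nat[OF assms(1)] by blast
  have "fp_dim p TYPE('a) = d"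
    unfolding fp_dim_def d
    using prime_gt_1_nat[OF assms(1)] by (intro the_equality) (auto simp: power_inject_exp)
  then show ?thesis
    by (simp add: eq d)
qed

theorem theorem2:
  fixes Q :: "'a::{finite,ab_group_add} \<Rightarrow> rat"
    and \<rho> :: "mp_elt \<Rightarrow> ('a \<Rightarrow> complex) \<Rightarrow> ('a \<Rightarrow> complex)"
    and p :: nat
  assumes "prime p"
    and "is_fqm Q" and "nondegenerate Q"
    and "\<exists>k. CARD('a) = p ^ k"
    and "fp_dim p TYPE('a) \<le> 2"
    and "weil_action Q \<rho>"
  shows "Inv \<rho> \<noteq> {\<lambda>_. 0} \<longleftrightarrow> (\<exists>n::nat. CARD('a) = n^2) \<and> sigma Q = 1"
proof -
  interpret quadratic_character "\<lambda>x. ee (Q x)" "\<lambda>x y. ee (Bf Q x y)"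
    by (rule quadratic_character_ee) fact+
  obtain k where k: "CARD('a) = p ^ k"
    using assms(4) by blast
  have tors: "card {x :: 'a. nmul p x = 0} \<le> p ^ 2"
    unfolding card_torsion_fp_dim[OF assms(1) k]
    using assms(5) prime_gt_0_nat[OF assms(1)] by (intro power_increasing) auto
  note dichotomy = self_dual_or_isotropic_subgrp[OF assms(1) k tors]
  have sigma_eq: "sigma Q = cnj (\<Sum>x\<in>UNIV. ee (Q x)) / of_real (sqrt (real CARD('a)))"
    by (simp add: sigma_def ee_minus cnj_sum)
  note W = assms(6)[unfolded weil_action_def]
  have \<rho>T: "\<rho> mp_T = T_op Q" and \<rho>S: "\<rho> mp_S = S_op Q" and \<rho>1: "\<And>v. \<rho> mp_one v = v"
    and mult: "\<And>g h v. g \<in> Mp \<Longrightarrow> h \<in> Mp \<Longrightarrow> \<rho> (mp_mult g h) v = \<rho> g (\<rho> h v)"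
    and scale: "\<And>g c u. g \<in> Mp \<Longrightarrow> \<rho> g (\<lambda>x. c * u x) = (\<lambda>x. c * \<rho> g u x)"
    using W by blast+
  show ?thesis
  proof
    assume nz: "Inv \<rho> \<noteq> {\<lambda>_. 0}"
    have "(\<lambda>_. 0) \<in> Inv \<rho>"
      using scale[of _ 0 "\<lambda>_. 0"] by (simp add: Inv_def)
    then obtain v where v: "v \<in> Inv \<rho>" "v \<noteq> (\<lambda>_. 0)"
      using nz by blast
    then obtain x where x: "v x \<noteq> 0" by auto
    have vT: "T_op Q v = v" and vS: "S_op Q v = v"
      using v(1) mp_T_in_Mp mp_S_in_Mp by (auto simp: Inv_def simp flip: \<rho>T \<rho>S)
    have supp: "z \<in> isotropic" if "v z \<noteq> 0" for z
      using fun_cong[OF vT, of z] that by (simp add: T_op_def isotropic_def)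
    have "\<exists>U. subgrp U \<and> U \<subseteq> isotropic \<and> perp U = U"
    proof (rule disjE[OF dichotomy])
      assume sI: "subgrp isotropic"
      have "perp isotropic \<subseteq> isotropic"
      proof
        fix h assume h: "h \<in> perp isotropic"
        \<comment> \<open>On the support of \<open>v\<close> the pairing with \<open>h\<close> is
          trivial, so \<open>S_op Q v\<close>, which is \<open>v\<close> itself, takes the same
          value at \<open>x + h\<close> as at \<open>x\<close>.\<close>
        have "ee (- Bf Q (x + h) z) * v z = ee (- Bf Q x z) * v z" for z
          using supp[of z] perpD[OF h, of z] by (cases "v z = 0") (auto simp: ee_minus b_add_left)
        then have "S_op Q v (x + h) = S_op Q v x"
          unfolding S_op_def by (simp only:)
        then have "x + h \<in> isotropic"
          using x supp by (simp add: vS)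
        then have "(x + h) - x \<in> isotropic"
          using supp[OF x] by (rule subgrp_diff[OF sI])
        then show "h \<in> isotropic" by simp
      qed
      then show ?thesis
        using sI isotropic_perp[OF sI] by blast
    qed
    then obtain U where U: "subgrp U" "U \<subseteq> isotropic" "perp U = U" by blast
    have card: "CARD('a) = card U ^ 2"
      using card_perp[OF U(1)] U(3) by (simp add: power2_eq_square)
    moreover have "sigma Q = 1"
      using subgrp_zero[OF U(1)] by (auto simp: sigma_eq self_dual_sum_q[OF U] card)
    ultimately show "(\<exists>n::nat. CARD('a) = n^2) \<and> sigma Q = 1" by blast
  next
    assume "(\<exists>n::nat. CARD('a) = n^2) \<and> sigma Q = 1"
    then obtain n where n: "CARD('a) = n^2" and \<sigma>: "sigma Q = 1" by blast
    have "n \<noteq> 0"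
      using n by (metis zero_power2 finite_UNIV_card_ge_0 finite less_irrefl)
    then have "cnj (\<Sum>x\<in>UNIV. ee (Q x)) = of_nat n"
      using \<sigma> by (simp add: sigma_eq n)
    then have "(\<Sum>x\<in>UNIV. ee (Q x)) = of_nat n"
      by (metis complex_cnj_cnj complex_cnj_of_nat)
    then have "\<exists>U. subgrp U \<and> U \<subseteq> isotropic \<and> perp U = U"
      using dichotomy isotropic_subgrp_self_dual[OF assms(1) k tors _ n] by blast
    then obtain U where U: "subgrp U" "U \<subseteq> isotropic" "perp U = U" by blast
    have cU: "card U = n"
      using card_perp[OF U(1)] U(3) n by (simp flip: power2_eq_square)
    define v where "v = (\<lambda>x. if x \<in> U then 1 else 0 :: complex)"
    have "T_op Q v = v"
      using U(2) by (intro ext) (auto simp: T_op_def v_def isotropic_def)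
    moreover have "S_op Q v = v"
    proof
      fix y
      \<comment> \<open>The Fourier transform of the indicator of \<open>U\<close> is
        \<open>card U\<close> times that of \<open>perp U = U\<close>; the factor \<open>n\<close>
        cancels against the normalisation \<open>sqrt (n^2)\<close>.\<close>
      have "(\<Sum>x\<in>UNIV. ee (- Bf Q y x) * v x) = (\<Sum>x\<in>UNIV. if x \<in> U then cnj (ee (Bf Q y x)) else 0)"
        by (intro sum.cong refl) (simp add: v_def ee_minus)
      also have "\<dots> = cnj (\<Sum>x\<in>U. ee (Bf Q y x))"
        by (simp add: sum.If_cases cnj_sum)
      also have "\<dots> = of_nat n * v y"
        by (simp add: sum_b[OF U(1)] U(3) cU v_def)
      finally show "S_op Q v y = v y"
        using \<open>n \<noteq> 0\<close> by (simp add: S_op_def \<sigma> n)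
    qed
    ultimately have "v \<in> Inv \<rho>"
      using Mp_fixed[of \<rho> v] mult \<rho>1 \<rho>T \<rho>S by (simp add: Inv_def)
    moreover have "v \<noteq> (\<lambda>_. 0)"
      using subgrp_zero[OF U(1)] by (metis v_def zero_neq_one)
    ultimately show "Inv \<rho> \<noteq> {\<lambda>_. 0}" by blast
  qed
qed

end
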